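(* Let $\mathbf{A} = \mathbf{A}^\mathsf{T} \in \mathbb{R}^{n\times n}$ be symmetric positive semidefinite (not necessarily nonsingular), and let $\mathbf{M} = \mathbf{M}^\mathsf{T} \in \mathbb{R}^{n\times n}$ be nonsingular with $\mathbf{A} = \mathbf{M} - \mathbf{N}$. Let $\ell \ge 1$ be an integer, $\mathbf{H} = \mathbf{M}^{-1}\mathbf{N}$, and $\mathbf{C}^{(\ell)} = \sum_{i=0}^{\ell-1}\mathbf{H}^i\mathbf{M}^{-1}$. Assume that $\mathbf{M}$ is definite if $\ell$ is odd, and that $\mathbf{M}+\mathbf{N}$ is definite if $\ell$ is even. Then the CG method preconditioned by $\ell$ steps of the inner iterations, i.e., with preconditioning matrix $\mathbf{C}^{(\ell)}$, determines a solution of $\mathbf{A}\mathbf{x} = \mathbf{b}$ for all $\mathbf{b} \in \mathcal{R}(\mathbf{A})$ and for all $\mathbf{x}_0 \in \mathbb{R}^n$.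
   Context: $\mathcal{R}(\cdot)$ denotes the range. A symmetric matrix is definite if it is either positive definite or negative definite. $\mathbf{C}^{(\ell)}$ is the matrix such that $\mathbf{C}^{(\ell)}\mathbf{r}$ is the $\ell$th iterate of the stationary iteration $\mathbf{z}^{(j)} = \mathbf{H}\mathbf{z}^{(j-1)} + \mathbf{M}^{-1}\mathbf{r}$ with $\mathbf{z}^{(0)} = \mathbf{0}$. Krylov subspace: $\mathcal{K}_k(\mathbf{B},\mathbf{v}) = \mathrm{span}\{\mathbf{v},\mathbf{B}\mathbf{v},\dots,\mathbf{B}^{k-1}\mathbf{v}\}$ (with $\mathcal{K}_0=\{\mathbf{0}\}$). CG preconditioned by $\mathbf{C}^{(\ell)}$: with initial iterate $\mathbf{x}_0$ and $\mathbf{r}_0 = \mathbf{b}-\mathbf{A}\mathbf{x}_0$, the $k$th iterate is the $\mathbf{x}_k \in \mathbf{x}_0 + \mathcal{K}_k(\mathbf{C}^{(\ell)}\mathbf{A}, \mathbf{C}^{(\ell)}\mathbf{r}_0)$ minimizing the seminorm $\|\mathbf{x}_k - \mathbf{x}_*\|_{\mathbf{A}}$, where $\|\mathbf{e}\|_{\mathbf{A}} = \sqrt{\mathbf{e}^\mathsf{T}\mathbf{A}\mathbf{e}}$ and $\mathbf{x}_*$ is a solution of $\mathbf{A}\mathbf{x}=\mathbf{b}$ (the seminorm does not depend on which solution is used). In algorithmic form: $\mathbf{z}_0=\mathbf{p}_0=\mathbf{C}^{(\ell)}\mathbf{r}_0$ and, for $k=0,1,\dots$ until $\mathbf{r}_k=\mathbf{0}$,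 $\alpha_k = \mathbf{r}_k^\mathsf{T}\mathbf{z}_k/\mathbf{p}_k^\mathsf{T}\mathbf{A}\mathbf{p}_k$, $\mathbf{x}_{k+1}=\mathbf{x}_k+\alpha_k\mathbf{p}_k$, $\mathbf{r}_{k+1}=\mathbf{r}_k-\alpha_k\mathbf{A}\mathbf{p}_k$, $\mathbf{z}_{k+1}=\mathbf{C}^{(\ell)}\mathbf{r}_{k+1}$, $\beta_k=\mathbf{r}_{k+1}^\mathsf{T}\mathbf{z}_{k+1}/\mathbf{r}_k^\mathsf{T}\mathbf{z}_k$, $\mathbf{p}_{k+1}=\mathbf{z}_{k+1}+\beta_k\mathbf{p}_k$. If $\mathbf{C}^{(\ell)}$ is negative definite, $-\mathbf{C}^{(\ell)}$ may be used in its place (this gives the same iterates). "Determines a solution" means: in exact arithmetic, there is some $k \ge 0$ such that the iterate $\mathbf{x}_k$ is well defined and satisfies $\mathbf{A}\mathbf{x}_k=\mathbf{b}$. *)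

theory Defs
  imports "HOL-Analysis.Analysis"
begin

section \<open>Symmetric, semidefinite and definite matrices\<close>

definition symmetric_matrix :: "real^'n^'n \<Rightarrow> bool" where
  "symmetric_matrix A \<longleftrightarrow> transpose A = A"

definition sym_pos_semidefinite :: "real^'n^'n \<Rightarrow> bool" where
  "sym_pos_semidefinite A \<longleftrightarrow> symmetric_matrix A \<and> (\<forall>x. 0 \<le> x \<bullet> (A *v x))"

definition sym_pos_definite :: "real^'n^'n \<Rightarrow> bool" where
  "sym_pos_definite A \<longleftrightarrow> symmetric_matrix A \<and> (\<forall>x. x \<noteq> 0 \<longrightarrow> 0 < x \<bullet> (A *v x))"

definition sym_neg_definite :: "real^'n^'n \<Rightarrow> bool" where
  "sym_neg_definite A \<longleftrightarrow> symmetric_matrix A \<and> (\<forall>x. x \<noteq> 0 \<longrightarrow> x \<bullet> (A *v x) < 0)"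

definition sym_definite :: "real^'n^'n \<Rightarrow> bool" where
  "sym_definite A \<longleftrightarrow> sym_pos_definite A \<or> sym_neg_definite A"

section \<open>The inner-iteration preconditioner\<close>

text \<open>Powers with respect to the matrix product: on the type of square matrices
  the library operations \<open>*\<close> and \<open>^\<close> act componentwise.\<close>

primrec matrix_power :: "real^'n^'n \<Rightarrow> nat \<Rightarrow> real^'n^'n" where
  "matrix_power B 0 = mat 1"
| "matrix_power B (Suc i) = B ** matrix_power B i"

definition inner_preconditioner :: "real^'n^'n \<Rightarrow> real^'n^'n \<Rightarrow> nat \<Rightarrow> real^'n^'n" where
  "inner_preconditioner M N l =
     (\<Sum>i<l. matrix_power (matrix_inv M ** N) i ** matrix_inv M)"

text \<open>The stationary iteration \<open>z\<^sub>j = H z\<^sub>j\<^sub>-\<^sub>1 + M\<^sup>-\<^sup>1 r\<close>, \<open>z\<^sub>0 = 0\<close>, with \<open>H = M\<^sup>-\<^sup>1 N\<close>,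
  whose \<open>l\<close>-th iterate the preconditioner computes.\<close>

primrec stationary_iterate ::
    "real^'n^'n \<Rightarrow> real^'n^'n \<Rightarrow> real^'n \<Rightarrow> nat \<Rightarrow> real^'n" where
  "stationary_iterate M N r 0 = 0"
| "stationary_iterate M N r (Suc j) =
     (matrix_inv M ** N) *v stationary_iterate M N r j + matrix_inv M *v r"

lemma inner_preconditioner_eq_stationary_iterate:
  fixes M N :: "real^'n^'n"
  shows "inner_preconditioner M N l *v r = stationary_iterate M N r l"
proof (induction l)
  case 0
  then show ?case by (simp add: inner_preconditioner_def)
next
  case (Suc l)
  let ?H = "matrix_inv M ** N"
  have mult_sum: "?H ** (\<Sum>i<k. f i) = (\<Sum>i<k. ?H ** f i)"
    for f :: "nat \<Rightarrow> real^'n^'n" and k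
    by (induction k) (simp_all add: matrix_add_ldistrib)
  have "inner_preconditioner M N (Suc l) = matrix_inv M + ?H ** inner_preconditioner M N l"
    unfolding inner_preconditioner_def sum.lessThan_Suc_shift mult_sum
    by (simp add: matrix_mul_assoc)
  with Suc show ?case
    by (simp add: matrix_vector_mult_add_rdistrib matrix_vector_mul_assoc[symmetric])
qed

section \<open>The preconditioned CG method\<close>

definition krylov :: "real^'n^'n \<Rightarrow> real^'n \<Rightarrow> nat \<Rightarrow> (real^'n) set" where
  "krylov B v k = span ((\<lambda>i. matrix_power B i *v v) ` {..<k})"

definition energy_seminorm :: "real^'n^'n \<Rightarrow> real^'n \<Rightarrow> real" where
  "energy_seminorm A e = sqrt (e \<bullet> (A *v e))"

definition cg_search_space ::
    "real^'n^'n \<Rightarrow> real^'n^'n \<Rightarrow> real^'n \<Rightarrow> real^'n \<Rightarrow> nat \<Rightarrow> (real^'n) set" where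
  "cg_search_space A C b x0 k = (+) x0 ` krylov (C ** A) (C *v (b - A *v x0)) k"

text \<open>\<open>x\<close> is the \<open>k\<close>-th CG iterate in the variational sense: for every solution \<open>xs\<close> of
  the system it minimizes the distance to \<open>xs\<close>, and no other point of the search space
  does. (The condition is only meaningful for a consistent system.)\<close>

definition cg_minimizer ::
    "real^'n^'n \<Rightarrow> real^'n^'n \<Rightarrow> real^'n \<Rightarrow> real^'n \<Rightarrow> nat \<Rightarrow> real^'n \<Rightarrow> bool" where
  "cg_minimizer A C b x0 k x \<longleftrightarrow>
     (\<forall>xs. A *v xs = b \<longrightarrow>
       (\<forall>y. is_arg_min (\<lambda>u. energy_seminorm A (u - xs))
              (\<lambda>u. u \<in> cg_search_space A C b x0 k) y \<longleftrightarrow> y = x))"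

text \<open>The CG recurrences. \<open>cg_run A C b x0 k x r z p\<close> states that the algorithm reaches
  step \<open>k\<close> without breakdown, with iterate \<open>x\<close>, residual \<open>r\<close>, preconditioned residual \<open>z\<close> and
  direction \<open>p\<close>. A step is taken only if the residual is nonzero and the two divisors, of
  \<open>\<alpha>\<close> and \<open>\<beta>\<close>, are nonzero, so that the convention \<open>a / 0 = 0\<close> is never used. A negative
  definite \<open>C\<close> needs no sign change, since \<open>C\<close> and \<open>- C\<close> yield the same iterates.\<close>

inductive cg_run ::
    "real^'n^'n \<Rightarrow> real^'n^'n \<Rightarrow> real^'n \<Rightarrow> real^'n \<Rightarrow>
     nat \<Rightarrow> real^'n \<Rightarrow> real^'n \<Rightarrow> real^'n \<Rightarrow> real^'n \<Rightarrow> bool"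
  for A C :: "real^'n^'n" and b x0 :: "real^'n" where
  start: "r = b - A *v x0 \<Longrightarrow> z = C *v r \<Longrightarrow> cg_run A C b x0 0 x0 r z z"
| step: "\<lbrakk>cg_run A C b x0 k x r z p; r \<noteq> 0; p \<bullet> (A *v p) \<noteq> 0; r \<bullet> z \<noteq> 0;
    \<alpha> = (r \<bullet> z) / (p \<bullet> (A *v p));
    x' = x + \<alpha> *\<^sub>R p;
    r' = r - \<alpha> *\<^sub>R (A *v p);
    z' = C *v r';
    \<beta> = (r' \<bullet> z') / (r \<bullet> z);
    p' = z' + \<beta> *\<^sub>R p\<rbrakk>
    \<Longrightarrow> cg_run A C b x0 (Suc k) x' r' z' p'"

text \<open>Some iterate is well defined, both as the unique minimizer and by the recurrences,
  and solves the system.\<close>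

definition cg_determines_solution ::
    "real^'n^'n \<Rightarrow> real^'n^'n \<Rightarrow> real^'n \<Rightarrow> real^'n \<Rightarrow> bool" where
  "cg_determines_solution A C b x0 \<longleftrightarrow>
     (\<exists>k x. cg_minimizer A C b x0 k x \<and>
            (\<exists>r z p. cg_run A C b x0 k x r z p) \<and>
            A *v x = b)"

end

theory Submission
  imports Defs
begin

text \<open>Write \<open>H = M\<^sup>-\<^sup>1 N\<close>. With \<open>x = M y\<close> one has \<open>x\<^sup>T C x = \<Sum>i<l. y\<^sup>T M H\<^sup>i y\<close>, and \<open>H\<close> is
  self-adjoint for the forms of \<open>M\<close> and of \<open>M + N = M (I + H)\<close>. The factorizations
  \<open>\<Sum>i<2m. t\<^sup>i = (1 + t) (\<Sum>j<m. t\<^sup>2\<^sup>j)\<close> and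
  \<open>2 (\<Sum>i\<le>2m. t\<^sup>i) = 1 + t\<^sup>2\<^sup>m + (\<Sum>j<m. t\<^sup>2\<^sup>j (1 + t)\<^sup>2)\<close> therefore show that the symmetric
  matrix \<open>C\<close> is definite. All search directions lie in \<open>C \<R>(A)\<close>, which meets the null space
  of \<open>A\<close> only in \<open>0\<close>, so the semidefinite \<open>A\<close> is definite there and the classical argument
  applies: as long as the residual is nonzero there is no breakdown and the Krylov spaces
  grow strictly.\<close>

section \<open>Symmetric matrices\<close>

lemma symmetric_matrix_inner:
  fixes A :: "real^'n^'n"
  assumes "symmetric_matrix A"
  shows "(A *v x) \<bullet> y = x \<bullet> (A *v y)"
  using assms by (metis dot_lmul_matrix symmetric_matrix_def transpose_matrix_vector)

lemma sym_definite_sign: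
  fixes A :: "real^'n^'n"
  assumes "sym_definite A"
  obtains s :: real where "\<And>x. x \<noteq> 0 \<Longrightarrow> 0 < s * (x \<bullet> (A *v x))"
proof (cases "sym_pos_definite A")
  case True
  then show ?thesis using that[of 1] by (simp add: sym_pos_definite_def)
next
  case False
  then show ?thesis using assms that[of "-1"]
    by (simp add: sym_definite_def sym_neg_definite_def)
qed

text \<open>On the line \<open>x + t *\<^sub>R y\<close> with \<open>y = A *v x\<close> the form is
  \<open>2 * t * (y \<bullet> y) + t\<^sup>2 * c\<close>, which takes negative values at small
  negative \<open>t\<close> unless \<open>y = 0\<close>.\<close>

lemma sym_pos_semidefinite_null:
  fixes A :: "real^'n^'n"
  assumes A: "sym_pos_semidefinite A" and x: "x \<bullet> (A *v x) = 0"
  shows "A *v x = 0"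
proof -
  have sym: "symmetric_matrix A" and pos: "\<And>v. 0 \<le> v \<bullet> (A *v v)"
    using A by (auto simp: sym_pos_semidefinite_def)
  define y where "y = A *v x"
  define c where "c = y \<bullet> (A *v y)"
  \<comment> \<open>The minimum of the quadratic suggests the divisor \<open>c\<close>;
    \<open>c + 1\<close> also covers \<open>c = 0\<close>.\<close>
  define t where "t = - (y \<bullet> y) / (c + 1)"
  have c: "0 \<le> c" using pos by (simp add: c_def)
  have "x \<bullet> (A *v y) = y \<bullet> y"
    by (simp add: y_def symmetric_matrix_inner[OF sym, symmetric])
  moreover have "y \<bullet> (A *v x) = y \<bullet> y" by (simp add: y_def)
  ultimately have "(x + t *\<^sub>R y) \<bullet> (A *v (x + t *\<^sub>R y)) = 2 * t * (y \<bullet> y) + t\<^sup>2 * c"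
    by (simp add: matrix_vector_right_distrib matrix_vector_mult_scaleR inner_add_left
        inner_add_right x c_def power2_eq_square algebra_simps)
  with pos have "0 \<le> 2 * t * (y \<bullet> y) + t\<^sup>2 * c" by metis
  also have "y \<bullet> y = - t * (c + 1)" using c by (simp add: t_def)
  finally have "t\<^sup>2 * (c + 2) \<le> 0" by (simp add: algebra_simps power2_eq_square)
  then have "t = 0" using c by (simp add: mult_le_0_iff)
  then show ?thesis using c by (simp add: t_def y_def)
qed

section \<open>Definiteness of the preconditioner\<close>

text \<open>By \<open>adj\<close>, factors of \<open>H\<close> cross the form of \<open>G\<close>
  one at a time, so only the total exponent matters.\<close>

lemma matrix_power_self_adjoint:
  fixes G H :: "real^'n^'n"
  assumes adj: "\<And>x y. (H *v x) \<bullet> (G *v y) = x \<bullet> (G *v (H *v y))"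
  shows "(matrix_power H i *v x) \<bullet> (G *v (matrix_power H j *v y))
         = x \<bullet> (G *v (matrix_power H (i + j) *v y))"
proof (induction i arbitrary: j)
  case (Suc i)
  have "(matrix_power H (Suc i) *v x) \<bullet> (G *v (matrix_power H j *v y))
      = (matrix_power H i *v x) \<bullet> (G *v (matrix_power H (Suc j) *v y))"
    by (simp add: matrix_vector_mul_assoc[symmetric] adj)
  then show ?case using Suc[of "Suc j"] by simp
qed simp

context
  fixes M N :: "real^'n^'n"
  assumes symM: "symmetric_matrix M" and symN: "symmetric_matrix N" and invM: "invertible M"
begin

lemma matrix_inv_mult: "matrix_inv M ** M = mat 1" and mult_matrix_inv: "M ** matrix_inv M = mat 1"
  using invM someI_ex[of "\<lambda>B. M ** B = mat 1 \<and> B ** M = mat 1"]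
  by (auto simp: invertible_def matrix_inv_def)

lemma mult_iteration_matrix: "M *v ((matrix_inv M ** N) *v x) = N *v x"
  by (simp add: matrix_vector_mul_assoc matrix_mul_assoc mult_matrix_inv)

text \<open>Since \<open>M ** H = N\<close> for \<open>H = matrix_inv M ** N\<close>, both sides
  equal \<open>x \<bullet> (N *v y)\<close>, by symmetry of \<open>M\<close> and
  \<open>N\<close>.\<close>

lemma iteration_matrix_self_adjoint:
  "((matrix_inv M ** N) *v x) \<bullet> (M *v y) = x \<bullet> (M *v ((matrix_inv M ** N) *v y))"
  by (simp add: symmetric_matrix_inner[OF symM, symmetric] mult_iteration_matrix)
     (simp add: symmetric_matrix_inner[OF symN] symmetric_matrix_inner[OF symM]
        mult_iteration_matrix)

lemmas power_iteration_matrix_self_adjoint =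
  matrix_power_self_adjoint[of "matrix_inv M ** N" M, OF iteration_matrix_self_adjoint]

lemma inner_preconditioner_mult:
  "inner_preconditioner M N l *v (M *v y) = (\<Sum>i<l. matrix_power (matrix_inv M ** N) i *v y)"
proof -
  have "(\<Sum>i<l. f i) *v x = (\<Sum>i<l. f i *v x)" for f :: "nat \<Rightarrow> real^'n^'n" and x
    by (induction l) (simp_all add: matrix_vector_mult_add_rdistrib)
  moreover have "(B ** matrix_inv M) *v (M *v y) = B *v y" for B :: "real^'n^'n"
    by (metis matrix_inv_mult matrix_mul_assoc matrix_mul_rid matrix_vector_mul_assoc)
  ultimately show ?thesis by (simp add: inner_preconditioner_def)
qed

lemma surj_mult: obtains y where "x = M *v y"
  by (metis mult_matrix_inv matrix_vector_mul_assoc matrix_vector_mul_lid)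

text \<open>Substituting \<open>M *v u\<close> and \<open>M *v v\<close> turns the bilinear form of
  the preconditioner into a sum of forms of \<open>M\<close> with powers of the iteration matrix,
  each of them symmetric.\<close>

lemma symmetric_inner_preconditioner: "symmetric_matrix (inner_preconditioner M N l)"
proof -
  let ?C = "inner_preconditioner M N l"
  have adj: "(?C *v x) \<bullet> y = x \<bullet> (?C *v y)" for x y
  proof -
    obtain u v where x: "x = M *v u" and y: "y = M *v v" by (metis surj_mult)
    show ?thesis
      unfolding x y inner_preconditioner_mult inner_sum_left inner_sum_right
        symmetric_matrix_inner[OF symM]
      using power_iteration_matrix_self_adjoint[of _ u 0 v] by simp
  qed
  have "transpose ?C *v x = ?C *v x" for x
    by (rule vector_eq_rdot[THEN iffD1])
       (metis adj dot_lmul_matrix inner_commute transpose_matrix_vector)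
  then show ?thesis
    by (simp add: symmetric_matrix_def matrix_eq)
qed

lemma inner_preconditioner_form_nonzero:
  assumes odd: "odd l \<Longrightarrow> sym_definite M"
    and even: "even l \<Longrightarrow> sym_definite (M + N)"
    and l: "l \<ge> 1" and x: "x \<noteq> 0"
  shows "x \<bullet> (inner_preconditioner M N l *v x) \<noteq> 0"
proof -
  define P where "P = matrix_power (matrix_inv M ** N)"
  obtain y where y: "x = M *v y" by (rule surj_mult)
  with x have y0: "y \<noteq> 0" by auto
  \<comment> \<open>The moments of \<open>y\<close>: the form of \<open>M\<close> between two
    iterates of \<open>y\<close> depends only on the sum of their exponents, so sums of moments can
    be regrouped into squares.\<close>
  define a where "a = (\<lambda>i. y \<bullet> (M *v (P i *v y)))"
  have a: "(P i *v y) \<bullet> (M *v (P j *v y)) = a (i + j)" for i j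
    unfolding a_def P_def by (rule power_iteration_matrix_self_adjoint)
  have form: "x \<bullet> (inner_preconditioner M N l *v x) = (\<Sum>i<l. a i)"
    by (simp add: y inner_preconditioner_mult inner_sum_right a_def P_def
        symmetric_matrix_inner[OF symM])
  show ?thesis
  proof (cases "odd l")
    case True
    then obtain m where m: "l = 2 * m + 1" by (elim oddE)
    obtain s where s: "\<And>v. v \<noteq> 0 \<Longrightarrow> 0 < s * (v \<bullet> (M *v v))"
      using sym_definite_sign odd[OF True] by blast
    then have s0: "0 \<le> s * (v \<bullet> (M *v v))" for v
      by (cases "v = 0") (auto intro: less_imp_le)
    define w where "w = (\<lambda>j. P j *v y + P (Suc j) *v y)"
    \<comment> \<open>The blocks count \<open>a 0\<close> and \<open>a (2 * m)\<close> once and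
      every moment between them twice; each block is the form of \<open>M\<close> at
      \<open>w j\<close>.\<close>
    have "2 * (\<Sum>i<2 * m + 1. a i) = a 0 + a (2 * m)
        + (\<Sum>j<m. a (2 * j) + 2 * a (2 * j + 1) + a (2 * j + 2))"
      by (induction m) (simp_all add: algebra_simps)
    also have "(\<Sum>j<m. a (2 * j) + 2 * a (2 * j + 1) + a (2 * j + 2))
        = (\<Sum>j<m. w j \<bullet> (M *v w j))"
    proof (rule sum.cong)
      fix j
      have "j + j = 2 * j" "j + Suc j = 2 * j + 1" "Suc j + j = 2 * j + 1" "Suc j + Suc j = 2 * j + 2"
        by simp_all
      then show "a (2 * j) + 2 * a (2 * j + 1) + a (2 * j + 2) = w j \<bullet> (M *v w j)"
        by (simp only: w_def matrix_vector_right_distrib inner_add_left inner_add_right a)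
    qed simp
    finally have "s * (2 * (\<Sum>i<l. a i)) = s * a 0 + s * a (2 * m)
        + (\<Sum>j<m. s * (w j \<bullet> (M *v w j)))"
      by (simp only: m distrib_left sum_distrib_left[of s])
    \<comment> \<open>Strictness has to come from here: the iteration matrix may be singular, so
      later iterates of \<open>y\<close> may vanish.\<close>
    moreover have "0 < s * a 0" using s[OF y0] by (simp add: a_def P_def)
    moreover have "0 \<le> s * a (2 * m)" using s0[of "P m *v y"] by (simp add: a flip: mult_2)
    moreover have "0 \<le> (\<Sum>j<m. s * (w j \<bullet> (M *v w j)))"
      by (intro sum_nonneg s0)
    ultimately show ?thesis unfolding form by (metis add_pos_nonneg less_irrefl mult_zero_right)
  next
    case False
    then obtain m where m: "l = 2 * m" by auto
    obtain s where s: "\<And>v. v \<noteq> 0 \<Longrightarrow> 0 < s * (v \<bullet> ((M + N) *v v))"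
      using sym_definite_sign even False by blast
    then have s0: "0 \<le> s * (v \<bullet> ((M + N) *v v))" for v
      by (cases "v = 0") (auto intro: less_imp_le)
    have pair: "a (2 * j) + a (2 * j + 1) = (P j *v y) \<bullet> ((M + N) *v (P j *v y))" for j
    proof -
      have "M *v (P (Suc j) *v y) = N *v (P j *v y)"
        by (simp add: P_def mult_iteration_matrix
            flip: matrix_vector_mul_assoc[of "matrix_inv M ** N"])
      then show ?thesis
        using a[of j j] a[of j "Suc j"]
        by (simp add: matrix_vector_mult_add_rdistrib inner_add_right flip: mult_2)
    qed
    have "(\<Sum>i<2 * m. a i) = (\<Sum>j<m. a (2 * j) + a (2 * j + 1))"
      by (induction m) simp_all
    then have "s * (\<Sum>i<l. a i) = (\<Sum>j<m. s * ((P j *v y) \<bullet> ((M + N) *v (P j *v y))))"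
      by (simp only: m pair sum_distrib_left)
    also have "0 < \<dots>"
    \<comment> \<open>The term \<open>j = 0\<close> exists because \<open>l\<close> is even and at
      least 1, and it is positive because \<open>P 0 *v y = y\<close>.\<close>
    proof (rule sum_pos2[of _ 0])
      show "0 \<in> {..<m}" using l m by simp
      show "0 < s * ((P 0 *v y) \<bullet> ((M + N) *v (P 0 *v y)))"
        using s[OF y0] by (simp add: P_def)
    qed (simp_all add: s0)
    finally show ?thesis unfolding form by auto
  qed
qed

end

section \<open>Krylov subspaces\<close>

lemma subspace_krylov: "subspace (krylov B v k)"
  by (simp add: krylov_def)

lemma krylov_Suc:
  fixes B :: "real^'n^'n"
  shows "krylov B v (Suc k) = span (insert (matrix_power B k *v v) (krylov B v k))"
proof -
  have "span (insert a G) = span (insert a (span G))" for a and G :: "(real^'n) set"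
    unfolding span_eq using span_mono[of G "insert a G"] by (auto intro: span_base)
  then show ?thesis by (simp add: krylov_def lessThan_Suc)
qed

lemma krylov_mono: "krylov B v k \<subseteq> krylov B v (Suc k)"
  unfolding krylov_Suc by (meson span_superset subset_insertI subset_trans)

lemma krylov_closed:
  assumes "s \<in> krylov B v k"
  shows "B *v s \<in> krylov B v (Suc k)"
proof -
  have "s \<in> span ((\<lambda>i. matrix_power B i *v v) ` {..<k})"
    using assms by (simp add: krylov_def)
  then show ?thesis
  proof (induction rule: span_induct_alt)
    case base
    then show ?case by (simp add: subspace_0[OF subspace_krylov])
  next
    case (step c w s)
    then obtain i where i: "i < k" and w: "w = matrix_power B i *v v" by auto
    have "B *v w \<in> krylov B v (Suc k)"
      unfolding krylov_def w
      by (rule span_base, rule image_eqI[of _ _ "Suc i"])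
         (simp_all add: i matrix_vector_mul_assoc)
    with step show ?case
      by (simp add: matrix_vector_right_distrib matrix_vector_mult_scaleR
          subspace_add subspace_scale subspace_krylov)
  qed
qed

text \<open>Every positive power ends on the left with \<open>C ** A\<close>; the zeroth vector
  \<open>C *v r\<close> lies in the image because \<open>r\<close> itself is in the range of
  \<open>A\<close>.\<close>

lemma krylov_subset_image:
  assumes r: "r \<in> range ((*v) A)"
  shows "krylov (C ** A) (C *v r) k \<subseteq> range ((*v) (C ** A))"
proof -
  have sub: "subspace (range ((*v) (C ** A)))"
    by (intro linear_subspace_image matrix_vector_mul_linear subspace_UNIV)
  obtain w where w: "r = A *v w" using r by auto
  have "matrix_power (C ** A) i *v (C *v r) \<in> range ((*v) (C ** A))" for i
    by (cases i) (auto simp: w matrix_vector_mul_assoc[symmetric])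
  then show ?thesis unfolding krylov_def by (intro span_minimal sub) auto
qed

section \<open>The conjugate gradient iteration\<close>

context
  fixes A C :: "real^'n^'n" and b x0 :: "real^'n"
  assumes A: "sym_pos_semidefinite A" and symC: "symmetric_matrix C"
    and C: "\<And>x. x \<noteq> 0 \<Longrightarrow> x \<bullet> (C *v x) \<noteq> 0" and b: "b \<in> range ((*v) A)"
begin

abbreviation "K k \<equiv> krylov (C ** A) (C *v (b - A *v x0)) k"

lemma symA: "symmetric_matrix A"
  using A by (simp add: sym_pos_semidefinite_def)

text \<open>Writing \<open>v = C *v (A *v w)\<close>, the form of \<open>C\<close> at
  \<open>A *v w\<close> equals \<open>w \<bullet> (A *v v) = 0\<close>, so
  \<open>A *v w = 0\<close>. Thus the semidefinite \<open>A\<close> is definite on every Krylov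
  space.\<close>

lemma krylov_null:
  assumes v: "v \<in> K k" and 0: "A *v v = 0"
  shows "v = 0"
proof -
  have "b - A *v x0 \<in> range ((*v) A)"
    using b by (auto simp: matrix_vector_mult_diff_distrib[symmetric])
  then obtain w where w: "v = C *v (A *v w)"
    using v krylov_subset_image[of _ A C k]
    by (metis (no_types, lifting) matrix_vector_mul_assoc rangeE subsetD)
  have "(A *v w) \<bullet> (C *v (A *v w)) = w \<bullet> (A *v v)"
    by (simp add: symmetric_matrix_inner[OF symA] w)
  with 0 have "A *v w = 0" using C by fastforce
  then show ?thesis by (simp add: w)
qed

text \<open>A solution attains the least possible seminorm 0, and any other minimizer would differ
  from it by a Krylov vector in the null space of \<open>A\<close>.\<close>

lemma cg_minimizer_solution:
  assumes x: "x \<in> cg_search_space A C b x0 k" and Ax: "A *v x = b"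
  shows "cg_minimizer A C b x0 k x"
  unfolding cg_minimizer_def
proof (intro allI impI)
  fix xs y assume xs: "A *v xs = b"
  have sub: "u - x \<in> K k" if "u \<in> cg_search_space A C b x0 k" for u
    using that x subspace_diff[OF subspace_krylov]
    by (fastforce simp: cg_search_space_def)
  have nonneg: "0 \<le> energy_seminorm A e" for e
    using A by (simp add: energy_seminorm_def sym_pos_semidefinite_def)
  have zero: "energy_seminorm A (u - xs) = 0 \<longleftrightarrow> A *v u = b" for u
    using sym_pos_semidefinite_null[OF A, of "u - xs"]
    by (auto simp: energy_seminorm_def matrix_vector_mult_diff_distrib xs)
  have uniq: "y = x" if "y \<in> cg_search_space A C b x0 k" "A *v y = b"
    using krylov_null[OF sub[OF that(1)]] that(2) Ax by (simp add: matrix_vector_mult_diff_distrib)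
  have x0: "energy_seminorm A (x - xs) = 0" using zero Ax by simp
  show "is_arg_min (\<lambda>u. energy_seminorm A (u - xs)) (\<lambda>u. u \<in> cg_search_space A C b x0 k) y
        \<longleftrightarrow> y = x"
    unfolding is_arg_min_def
    using x x0 nonneg zero uniq by (metis antisym_conv2 leD)
qed

text \<open>Orthogonality and conjugacy are stated against whole Krylov spaces instead of against
  earlier vectors, so no history of the run is kept. The dimension bound forces termination.\<close>

definition cg_invariant where
  "cg_invariant k x r z p \<longleftrightarrow>
     cg_run A C b x0 k x r z p \<and> r = b - A *v x \<and> z = C *v r \<and> x - x0 \<in> K k \<and>
     p - z \<in> K k \<and> z \<in> K (Suc k) \<and>
     (\<forall>s\<in>K k. r \<bullet> s = 0) \<and> (\<forall>s\<in>K k. p \<bullet> (A *v s) = 0) \<and> k \<le> dim (K k)"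

lemma cg_invariant_start:
  "cg_invariant 0 x0 (b - A *v x0) (C *v (b - A *v x0)) (C *v (b - A *v x0))"
  by (auto simp: cg_invariant_def krylov_def intro!: cg_run.start span_base)

lemma cg_invariant_step:
  assumes inv: "cg_invariant k x r z p" and r0: "r \<noteq> 0"
  shows "\<exists>x' r' z' p'. cg_invariant (Suc k) x' r' z' p'"
proof -
  have run: "cg_run A C b x0 k x r z p" and r: "r = b - A *v x" and z: "z = C *v r"
    and x: "x - x0 \<in> K k" and pz: "p - z \<in> K k" and zK: "z \<in> K (Suc k)"
    and rK: "\<And>s. s \<in> K k \<Longrightarrow> r \<bullet> s = 0" and pK: "\<And>s. s \<in> K k \<Longrightarrow> p \<bullet> (A *v s) = 0"
    and dim: "k \<le> dim (K k)"
    using inv unfolding cg_invariant_def by blast+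
  note sub = subspace_krylov[of "C ** A" "C *v (b - A *v x0)"]
  have mono: "s \<in> K (Suc k)" if "s \<in> K k" for s
    using that krylov_mono by blast
  have rz: "r \<bullet> z \<noteq> 0" using C[OF r0] z by simp
  have rp: "r \<bullet> p = r \<bullet> z"
    using rK[OF pz] by (simp add: inner_diff_right)
  have pS: "p \<in> K (Suc k)"
    using subspace_add[OF sub mono[OF pz] zK] by simp
  have p0: "p \<noteq> 0" using rp rz by auto
  have pAp: "p \<bullet> (A *v p) \<noteq> 0"
    using krylov_null[OF pS] sym_pos_semidefinite_null[OF A] p0 by blast
  \<comment> \<open>The residual annihilates \<open>K k\<close> but not \<open>p\<close>; this is
    what makes the Krylov spaces grow strictly.\<close>
  have pnK: "p \<notin> K k" using rK rp rz by auto
  have spK: "span (K k) = K k" using sub by simp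
  \<comment> \<open>Exchange: \<open>p\<close> replaces the newest Krylov power as a generator, so
    orthogonality to \<open>K (Suc k)\<close> need only be checked on \<open>p\<close> and
    \<open>K k\<close>.\<close>
  have KSuc: "K (Suc k) = span (insert p (K k))"
  proof -
    let ?v = "matrix_power (C ** A) k *v (C *v (b - A *v x0))"
    have "?v \<in> span (insert p (K k))"
      using in_span_insert[of p ?v "K k"] pS pnK spK by (simp add: krylov_Suc)
    then have "K (Suc k) \<subseteq> span (insert p (K k))"
      unfolding krylov_Suc by (intro span_minimal) (auto intro: span_base)
    moreover have "span (insert p (K k)) \<subseteq> K (Suc k)"
      by (intro span_minimal sub) (use pS mono in auto)
    ultimately show ?thesis by blast
  qed
  define \<alpha> where "\<alpha> = (r \<bullet> z) / (p \<bullet> (A *v p))"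
  define x' where "x' = x + \<alpha> *\<^sub>R p"
  define r' where "r' = r - \<alpha> *\<^sub>R (A *v p)"
  define z' where "z' = C *v r'"
  define \<beta> where "\<beta> = (r' \<bullet> z') / (r \<bullet> z)"
  define p' where "p' = z' + \<beta> *\<^sub>R p"
  have \<alpha>0: "\<alpha> \<noteq> 0" using rz pAp by (simp add: \<alpha>_def)
  have orth: "v \<bullet> s = 0" if "v \<bullet> p = 0" "\<And>s. s \<in> K k \<Longrightarrow> v \<bullet> s = 0" "s \<in> K (Suc k)" for v s
  proof -
    have "orthogonal v s"
      using that unfolding KSuc by (elim orthogonal_to_span) (auto simp: orthogonal_def)
    then show ?thesis by (simp add: orthogonal_def)
  qed
  have "r' \<bullet> p = 0"
    using pAp by (simp add: r'_def inner_diff_left rp \<alpha>_def inner_commute[of "A *v p" p])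
  moreover have "r' \<bullet> s = 0" if "s \<in> K k" for s
    using rK[OF that] pK[OF that]
    by (simp add: r'_def inner_diff_left symmetric_matrix_inner[OF symA])
  ultimately have r'K: "r' \<bullet> s = 0" if "s \<in> K (Suc k)" for s
    using orth that by blast
  have z': "z' = z - \<alpha> *\<^sub>R ((C ** A) *v p)"
    by (simp add: z'_def r'_def z matrix_vector_mult_diff_distrib matrix_vector_mult_scaleR
        matrix_vector_mul_assoc)
  have z'K: "z' \<in> K (Suc (Suc k))"
    unfolding z'
    by (intro subspace_diff subspace_scale sub krylov_closed pS) (use zK krylov_mono in blast)
  have z'A: "z' \<bullet> v = r' \<bullet> (C *v v)" for v
    by (simp add: z'_def symmetric_matrix_inner[OF symC])
  \<comment> \<open>Here \<open>\<alpha> *\<^sub>R (A *v p) = r - r'\<close>, and symmetry of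
    \<open>C\<close> turns \<open>z' \<bullet> r\<close> into \<open>r' \<bullet> z = 0\<close>; the
    choice of \<beta> then makes \<open>p'\<close> conjugate to \<open>p\<close>.\<close>
  have "z' \<bullet> (\<alpha> *\<^sub>R (A *v p)) = z' \<bullet> r - z' \<bullet> r'"
    by (simp add: r'_def inner_diff_right)
  also have "z' \<bullet> r = 0" using r'K[OF zK] by (simp add: z'A z)
  finally have "\<alpha> * (z' \<bullet> (A *v p)) = - (r' \<bullet> z')" by (simp add: inner_commute)
  moreover have "\<alpha> * (\<beta> * (p \<bullet> (A *v p))) = r' \<bullet> z'"
    using rz pAp by (simp add: \<alpha>_def \<beta>_def)
  ultimately have "\<alpha> * (p' \<bullet> (A *v p)) = 0"
    by (simp add: p'_def inner_add_left distrib_left)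
  with \<alpha>0 have "p' \<bullet> (A *v p) = 0" by simp
  \<comment> \<open>Why a single correction term suffices: for \<open>s\<close> in
    \<open>K k\<close>, \<open>C *v (A *v s)\<close> lies in \<open>K (Suc k)\<close>, to which
    \<open>r'\<close> is already orthogonal.\<close>
  moreover have "p' \<bullet> (A *v s) = 0" if "s \<in> K k" for s
    using r'K[OF krylov_closed[OF that]] pK[OF that]
    by (simp add: p'_def inner_add_left z'A matrix_vector_mul_assoc)
  ultimately have p'K: "p' \<bullet> (A *v s) = 0" if "s \<in> K (Suc k)" for s
    using orth[of "A *v p'" s] that by (simp add: symmetric_matrix_inner[OF symA])
  have "cg_run A C b x0 (Suc k) x' r' z' p'"
    by (rule cg_run.step[OF run r0 pAp rz \<alpha>_def x'_def r'_def z'_def \<beta>_def p'_def])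
  moreover have "r' = b - A *v x'"
    by (simp add: r'_def r x'_def matrix_vector_right_distrib matrix_vector_mult_scaleR)
  moreover have "x' - x0 \<in> K (Suc k)"
    using subspace_add[OF sub mono[OF x] subspace_scale[OF sub pS, of \<alpha>]]
    by (simp add: x'_def algebra_simps)
  moreover have "p' - z' \<in> K (Suc k)"
    by (simp add: p'_def subspace_scale[OF sub pS])
  moreover have "Suc k \<le> dim (K (Suc k))"
    using dim pnK by (simp add: KSuc dim_insert spK)
  ultimately show ?thesis
    unfolding cg_invariant_def using z'_def z'K r'K p'K by blast
qed

text \<open>If no iterate solved the system, the residual would never vanish and the invariant would
  hold at every step, giving a Krylov space of dimension above that of the whole space.\<close>

lemma cg_determines_solution_of_definite: "cg_determines_solution A C b x0"
proof (rule ccontr)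
  assume no: "\<not> ?thesis"
  have "\<exists>x r z p. cg_invariant k x r z p" for k
  proof (induction k)
    case 0
    then show ?case using cg_invariant_start by blast
  next
    case (Suc k)
    then obtain x r z p where inv: "cg_invariant k x r z p" by blast
    have "r \<noteq> 0"
    proof
      assume "r = 0"
      then have "A *v x = b" and run: "cg_run A C b x0 k x r z p" and xK: "x - x0 \<in> K k"
        using inv by (auto simp: cg_invariant_def)
      moreover have "x \<in> cg_search_space A C b x0 k"
        unfolding cg_search_space_def using xK by (intro image_eqI[of _ _ "x - x0"]) auto
      ultimately show False
        using no cg_minimizer_solution unfolding cg_determines_solution_def by blast
    qed
    then show ?case using cg_invariant_step[OF inv] by blast
  qed
  then have "Suc CARD('n) \<le> dim (K (Suc CARD('n)))"
    unfolding cg_invariant_def by blast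
  also have "\<dots> \<le> CARD('n)"
    by (metis DIM_cart DIM_real dim_subset_UNIV mult.right_neutral)
  finally show False by simp
qed

end

theorem theorem2p7:
  fixes A M N :: "real^'n^'n" and l :: nat
  assumes "sym_pos_semidefinite A"
    and "symmetric_matrix M" and "invertible M"
    and "A = M - N"
    and "l \<ge> 1"
    and "odd l \<longrightarrow> sym_definite M"
    and "even l \<longrightarrow> sym_definite (M + N)"
  shows "\<forall>b \<in> range ((*v) A). \<forall>x0.
           cg_determines_solution A (inner_preconditioner M N l) b x0"
proof (intro ballI allI)
  fix b x0 assume b: "b \<in> range ((*v) A)"
  have N: "N = M - A" using assms(4) by simp
  have "transpose (M - A) = transpose M - transpose A"
    by (simp add: transpose_def vec_eq_iff)
  then have symN: "symmetric_matrix N"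
    using assms(1,2) by (simp add: N symmetric_matrix_def sym_pos_semidefinite_def)
  show "cg_determines_solution A (inner_preconditioner M N l) b x0"
    using assms b symN
    by (intro cg_determines_solution_of_definite symmetric_inner_preconditioner
        inner_preconditioner_form_nonzero) auto
qed

end
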